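(* Let $J$ be an $n\times n$ information matrix, i.e. a real symmetric positive definite matrix, and let $\mathcal{G}=(\mathcal{V},\mathcal{E})$ be its associated graph. For vertices $\alpha,\omega\in\mathcal{V}$ let $\Pi_{\mathcal{G};\alpha\omega}$ be the set of simple paths from $\alpha$ to $\omega$ on $\mathcal{G}$ and let $\Gamma_{\mathcal{G};\alpha}$ be the set of simple cycles from $\alpha$ to itself on $\mathcal{G}$. Since $\mathcal{G}$ has finitely many vertices and edges, these two sets are finite. Then each entry of the covariance matrix $\Sigma=J^{-1}$ admits an expression involving only weighted simple paths and simple cycles, given explicitly, for all $\alpha,\omega\in\mathcal{V}$, by $$(J^{-1})_{\omega\alpha}=\sum_{p\in\Pi_{\mathcal{G};\alpha\omega}}(-1)^{\ell(p)}\left[\prod_{j=2}^{\ell(p)+1}\Big\{\big((J_{\mathcal{G}\setminus\{\alpha,\nu_2,\dots,\nu_{j-1}\}})^{-1}\big)_{\nu_j\nu_j}\,J_{\nu_j\nu_{j-1}}\Big\}\right](J^{-1})_{\alpha\alpha},$$ $$(J^{-1})_{\alpha\alpha}=\left(\sum_{\gamma\in\Gamma_{\mathcal{G};\alpha}}(-1)^{\ell(\gamma)+1}\,J_{\mu_1\mu_{\ell(\gamma)}}\prod_{j=2}^{\ell(\gamma)}\Big\{\big((J_{\mathcal{G}\setminus\{\alpha,\mu_2,\dots,\mu_{j-1}\}})^{-1}\big)_{\mu_j\mu_j}\,J_{\mu_j\mu_{j-1}}\Big\}\right)^{-1}.$$ Here $p=(\nu_1,\nu_2,\dots,\nu_{\ell(p)+1})$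 is a simple path of length $\ell(p)$ with $\nu_1=\alpha$ and $\nu_{\ell(p)+1}=\omega$, and $\gamma=(\mu_1,\mu_2,\dots,\mu_{\ell(\gamma)},\mu_1)$ is a simple cycle of length $\ell(\gamma)$ with $\mu_1=\alpha$. Products are ordered right-to-left, $\prod_{i=1}^m a_i=a_m\cdots a_1$.
   Context: The graph $\mathcal{G}=(\mathcal{V},\mathcal{E})$ associated with the symmetric matrix $J$ has vertex set $\mathcal{V}=\{1,\dots,n\}$, and $(i,j)\in\mathcal{E}$ if and only if $J_{ij}\neq 0$, for all $i,j$ (including $i=j$, so there is a self-loop at every vertex with non-zero diagonal entry; all of them, since $J$ is positive definite). A walk of length $\ell$ is a sequence of $\ell+1$ vertices, consecutive ones being joined by an edge. A simple path is a walk whose vertices are all distinct (the trivial walk $(\alpha)$ of length $0$ is the only simple path from $\alpha$ to itself). A simple cycle from $\alpha$ to itself is a walk of length at least $1$ that starts and ends at $\alpha$ and whose intermediate vertices (from the second to the penultimate) are all distinct and different from $\alpha$. In particular the self-loop $(\alpha,\alpha)$ has length 1 and the backtracks $(\alpha,\beta,\alpha)$, $\beta\ne\alpha$, have length 2; walks are oriented, so a cycle of length at least 3 and its reversal are different simple cycles. For $S\subset\mathcal{V}$, $\mathcal{G}\setminus S$ is the subgraph obtained by deleting the vertices of $S$ and all edges incident to them, and $J_{\mathcal{G}\setminus S}$ is the principal submatrix of $J$ obtained by deleting the rows and columns indexed by $S$; its entries keep the original vertex labels as indices. For $j=2$ the set $\{\alpha,\nu_2,\dots,\nu_{j-1}\}$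 means $\{\alpha\}$ (likewise for the $\mu$'s). Empty products equal $1$. The diagonal entries of inverses of principal submatrices in the formulas are themselves given by the second formula applied on the corresponding subgraph, so that the expression is a finite recursion. *)

theory Defs
  imports
    "HOL-Analysis.Analysis"
    "Graph_Theory.Digraph_Component"
    "Graph_Theory.Vertex_Walk"
begin

definition information_matrix :: "real^'n^'n \<Rightarrow> bool" where
  "information_matrix J \<longleftrightarrow> transpose J = J \<and> (\<forall>x. x \<noteq> 0 \<longrightarrow> x \<bullet> (J *v x) > 0)"

definition matrix_graph :: "real^'n^'n \<Rightarrow> ('n, 'n \<times> 'n) pre_digraph" where
  "matrix_graph J = \<lparr>verts = UNIV, arcs = {(i, j). J $ i $ j \<noteq> 0}, tail = fst, head = snd\<rparr>"

definition delete_verts :: "('a, 'b) pre_digraph \<Rightarrow> 'a set \<Rightarrow> ('a, 'b) pre_digraph" where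
  "delete_verts G S = G \<restriction> (verts G - S)"

text \<open>Walks are vertex lists, so the walk $(\nu_1, \dots, \nu_{\ell+1})$ is a list
  with \<open>\<nu>\<^sub>j = p ! (j - 1)\<close>, and \<^const>\<open>vwalk_length\<close> counts its edges.\<close>

definition simple_paths :: "('a, 'b) pre_digraph \<Rightarrow> 'a \<Rightarrow> 'a \<Rightarrow> 'a vwalk set" where
  "simple_paths G \<alpha> \<omega> = {p. vpath p G \<and> hd p = \<alpha> \<and> last p = \<omega>}"

text \<open>The closing vertex is part of the list: the self-loop at \<open>\<alpha>\<close> is \<open>[\<alpha>, \<alpha>]\<close>, and
  \<open>tl (butlast \<gamma>)\<close> lists the vertices from the second to the penultimate.\<close>

definition simple_cycles :: "('a, 'b) pre_digraph \<Rightarrow> 'a \<Rightarrow> 'a vwalk set" where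
  "simple_cycles G \<alpha> = {\<gamma>. vwalk \<gamma> G \<and> vwalk_length \<gamma> \<ge> 1 \<and> hd \<gamma> = \<alpha> \<and> last \<gamma> = \<alpha> \<and>
     distinct (tl (butlast \<gamma>)) \<and> \<alpha> \<notin> set (tl (butlast \<gamma>))}"

text \<open>Inverse of the principal submatrix of \<open>J\<close> with the rows and columns in \<open>S\<close> deleted.
  Rows and columns keep their labels, so the matrix is a function on \<open>- S\<close>; as with
  \<^const>\<open>matrix_inv\<close>, it is a two-sided inverse whenever one exists. Its entries with an
  index in \<open>S\<close> are meaningless.\<close>

definition principal_inverse :: "real^'n^'n \<Rightarrow> 'n set \<Rightarrow> 'n \<Rightarrow> 'n \<Rightarrow> real" where
  "principal_inverse J S = (SOME B. \<forall>i\<in>-S. \<forall>j\<in>-S.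
     (\<Sum>k\<in>-S. J $ i $ k * B k j) = (if i = j then 1 else 0) \<and>
     (\<Sum>k\<in>-S. B i k * J $ k $ j) = (if i = j then 1 else 0))"

text \<open>The product over \<open>j = 2, \<dots>, m\<close> along the walk \<open>p\<close> in the graph with \<open>S\<close> deleted;
  \<open>set (take (j - 1) p)\<close> is $\{\nu_1, \dots, \nu_{j-1}\}$.\<close>

definition walk_product :: "real^'n^'n \<Rightarrow> 'n set \<Rightarrow> 'n vwalk \<Rightarrow> nat \<Rightarrow> real" where
  "walk_product J S p m = (\<Prod>j=2..m.
     principal_inverse J (S \<union> set (take (j - 1) p)) (p ! (j - 1)) (p ! (j - 1)) *
     J $ (p ! (j - 1)) $ (p ! (j - 2)))"

end

theory Submission
  imports Defs
begin

text \<open>Write \<open>P\<^sub>S\<close> for the inverse of \<open>J\<close> with \<open>S\<close> deleted. The column equations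
  \<open>J P\<^sub>S = 1\<close> at rows other than \<open>\<alpha>\<close>, multiplied by the inverse with \<open>\<alpha>\<close> deleted as well, give
  \<open>P\<^sub>S(\<omega>,\<alpha>) = - \<Sum>\<^sub>\<beta> P\<^sub>S\<^sub>\<alpha>(\<omega>,\<beta>) J(\<beta>,\<alpha>) P\<^sub>S(\<alpha>,\<alpha>)\<close>. Iterating this over growing \<open>S\<close> peels
  vertices off the front of a path and never returns to them, which yields the sum over simple
  paths. Substituted into the remaining row \<open>\<alpha>\<close>, it yields the sum over simple cycles.\<close>

section \<open>Inverses of principal submatrices\<close>

lemma information_matrix_sym:
  "information_matrix J \<Longrightarrow> J $ i $ j = J $ j $ i"
  by (simp add: information_matrix_def transpose_def vec_eq_iff)

text \<open>The compression of \<open>J\<close> to the complement of \<open>S\<close>, padded by the identity on \<open>S\<close>, is still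
  injective, and its inverse restricts to an inverse of the principal submatrix.\<close>

lemma principal_inverse_exists:
  fixes J :: "real^'n^'n"
  assumes "information_matrix J"
  shows "\<exists>B. \<forall>i\<in>-S. \<forall>j\<in>-S.
     (\<Sum>k\<in>-S. J $ i $ k * B k j) = (if i = j then 1 else 0) \<and>
     (\<Sum>k\<in>-S. B i k * J $ k $ j) = (if i = j then 1 else (0::real))"
proof -
  define M :: "real^'n^'n" where
    "M = (\<chi> i j. if i \<in> S \<or> j \<in> S then (if i = j then 1 else 0) else J $ i $ j)"
  have "x = 0" if "M *v x = 0" for x
  proof -
    have Mx: "(\<Sum>j\<in>UNIV. M $ i $ j * x $ j) = 0" for i
      using that by (simp add: matrix_vector_mult_def vec_eq_iff)
    have xS: "x $ i = 0" if "i \<in> S" for i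
    proof -
      have "(\<Sum>j\<in>UNIV. M $ i $ j * x $ j) = (\<Sum>j\<in>UNIV. if i = j then x $ j else 0)"
        by (rule sum.cong) (use that in \<open>auto simp: M_def\<close>)
      then show ?thesis using Mx[of i] by simp
    qed
    have "(J *v x) $ i = 0" if "i \<notin> S" for i
    proof -
      have "(J *v x) $ i = (\<Sum>j\<in>UNIV. M $ i $ j * x $ j)"
        unfolding matrix_vector_mult_def
        by (simp, rule sum.cong) (use that xS in \<open>auto simp: M_def\<close>)
      then show ?thesis using Mx by simp
    qed
    \<comment> \<open>Every summand vanishes: \<open>x $ i\<close> is zero on \<open>S\<close>, and
      \<open>(J *v x) $ i\<close> is zero off \<open>S\<close>. Positive definiteness then forces
      \<open>x = 0\<close>.\<close>
    then have "x \<bullet> (J *v x) = 0"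
      using xS unfolding inner_vec_def inner_real_def by (intro sum.neutral) auto
    then show "x = 0"
      using assms unfolding information_matrix_def by (metis less_irrefl)
  qed
  then obtain B where "B ** M = mat 1"
    using matrix_left_invertible_ker by blast
  then have BM: "(\<Sum>k\<in>UNIV. B $ i $ k * M $ k $ j) = (if i = j then 1 else 0)"
    and MB: "(\<Sum>k\<in>UNIV. M $ i $ k * B $ k $ j) = (if i = j then 1 else 0)" for i j
    using matrix_left_right_inverse[of B M]
    by (simp_all add: matrix_matrix_mult_def mat_def vec_eq_iff)
  have "(\<Sum>k\<in>-S. J $ i $ k * B $ k $ j) = (if i = j then 1 else 0) \<and>
     (\<Sum>k\<in>-S. B $ i $ k * J $ k $ j) = (if i = j then 1 else 0)"
    if "i \<in> -S" "j \<in> -S" for i j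
  proof -
    \<comment> \<open>Rows and columns of \<open>M\<close> with a label outside \<open>S\<close> are
      zero at labels inside \<open>S\<close>, so the full sum loses its terms with \<open>k\<close>
      in \<open>S\<close>.\<close>
    have "(\<Sum>k\<in>-S. J $ i $ k * B $ k $ j) = (\<Sum>k\<in>UNIV. M $ i $ k * B $ k $ j)"
      by (rule sum.mono_neutral_cong_left) (use that in \<open>auto simp: M_def\<close>)
    moreover have "(\<Sum>k\<in>-S. B $ i $ k * J $ k $ j) = (\<Sum>k\<in>UNIV. B $ i $ k * M $ k $ j)"
      by (rule sum.mono_neutral_cong_left) (use that in \<open>auto simp: M_def\<close>)
    ultimately show ?thesis using BM MB by simp
  qed
  then show ?thesis by (intro exI[of _ "\<lambda>i j. B $ i $ j"]) blast
qed

text \<open>The Hilbert choice behind \<open>principal_inverse\<close> is resolved only here; later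
  arguments use just these two families of equations, which say nothing about labels in
  \<open>S\<close>.\<close>

lemma
  fixes J :: "real^'n^'n"
  assumes "information_matrix J" "i \<notin> S" "j \<notin> S"
  shows principal_inverse_right:
      "(\<Sum>k\<in>-S. J $ i $ k * principal_inverse J S k j) = (if i = j then 1 else 0)"
    and principal_inverse_left:
      "(\<Sum>k\<in>-S. principal_inverse J S i k * J $ k $ j) = (if i = j then 1 else 0)"
  using someI_ex[OF principal_inverse_exists[OF assms(1), of S]] assms(2,3)
  unfolding principal_inverse_def[symmetric] by auto

lemma matrix_inv_eq_principal_inverse:
  fixes J :: "real^'n^'n"
  assumes "information_matrix J"
  shows "matrix_inv J $ i $ j = principal_inverse J {} i j"
proof -
  define P where "P = (\<chi> i j. principal_inverse J {} i j)"
  have P: "J ** P = mat 1" "P ** J = mat 1"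
    using principal_inverse_right[OF assms, of _ "{}"] principal_inverse_left[OF assms, of _ "{}"]
    by (simp_all add: P_def matrix_matrix_mult_def mat_def vec_eq_iff)
  \<comment> \<open>\<open>matrix_inv\<close> is a choice too; \<open>P\<close> witnesses that its
    specification can be met, and a left inverse agrees with the right inverse
    \<open>P\<close>.\<close>
  then have "matrix_inv J ** J = mat 1"
    unfolding matrix_inv_def by (metis (mono_tags, lifting) someI)
  with P(1) have "matrix_inv J = P"
    by (metis matrix_mul_assoc matrix_mul_lid matrix_mul_rid)
  then show ?thesis by (simp add: P_def)
qed

section \<open>Elimination of one vertex\<close>

lemma principal_inverse_column:
  fixes J :: "real^'n^'n"
  assumes J: "information_matrix J" and a: "a \<notin> S" and w: "w \<notin> insert a S"
  shows "principal_inverse J S w a =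
    - (\<Sum>b\<in>-insert a S. principal_inverse J (insert a S) w b * J $ b $ a) * principal_inverse J S a a"
proof -
  let ?P = "principal_inverse J S" and ?Q = "principal_inverse J (insert a S)"
  let ?T = "- insert a S"
  have ST: "- S = insert a ?T" "a \<notin> ?T" using a by auto
  have row: "(\<Sum>k\<in>?T. J $ i $ k * ?P k a) = - (J $ i $ a * ?P a a)" if "i \<in> ?T" for i
    using principal_inverse_right[OF J, of i S a] that a
    unfolding ST(1) by (subst (asm) sum.insert) auto
  \<comment> \<open>The identity on \<open>?T\<close> is inserted as \<open>?Q\<close> times
    \<open>J\<close>; once the sums are swapped, the inner one is the left side of
    \<open>row\<close>.\<close>
  have "?P w a = (\<Sum>k\<in>?T. (if w = k then 1 else 0) * ?P k a)"
    using w by (simp add: if_distrib[of "\<lambda>x. x * _"] cong: if_cong)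
  also have "\<dots> = (\<Sum>k\<in>?T. (\<Sum>i\<in>?T. ?Q w i * J $ i $ k) * ?P k a)"
    by (rule sum.cong) (use principal_inverse_left[OF J w] in auto)
  also have "\<dots> = (\<Sum>i\<in>?T. ?Q w i * (\<Sum>k\<in>?T. J $ i $ k * ?P k a))"
    unfolding sum_distrib_left sum_distrib_right by (subst sum.swap) (simp add: mult.assoc)
  also have "\<dots> = (\<Sum>i\<in>?T. ?Q w i * - (J $ i $ a * ?P a a))"
    by (rule sum.cong) (use row in auto)
  also have "\<dots> = - (\<Sum>b\<in>?T. ?Q w b * J $ b $ a) * ?P a a"
    by (simp add: sum_negf sum_distrib_right mult.assoc)
  finally show ?thesis .
qed

text \<open>The bracket is the Schur complement of the block on \<open>- insert a S\<close>. Row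
  \<open>a\<close> shows that it times the diagonal entry is 1, which gives its invertibility along
  with the value.\<close>

lemma principal_inverse_diag:
  fixes J :: "real^'n^'n"
  assumes J: "information_matrix J" and a: "a \<notin> S"
  shows "principal_inverse J S a a = inverse (J $ a $ a -
    (\<Sum>k\<in>-insert a S. \<Sum>b\<in>-insert a S. J $ a $ k * principal_inverse J (insert a S) k b * J $ b $ a))"
proof -
  let ?P = "principal_inverse J S" and ?Q = "principal_inverse J (insert a S)"
  let ?T = "- insert a S"
  have ST: "- S = insert a ?T" "a \<notin> ?T" using a by auto
  have "1 = J $ a $ a * ?P a a + (\<Sum>k\<in>?T. J $ a $ k * ?P k a)"
    using principal_inverse_right[OF J a a] unfolding ST(1) by (subst (asm) sum.insert) auto
  also have "(\<Sum>k\<in>?T. J $ a $ k * ?P k a) =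
      (\<Sum>k\<in>?T. J $ a $ k * (- (\<Sum>b\<in>?T. ?Q k b * J $ b $ a) * ?P a a))"
    by (rule sum.cong) (use principal_inverse_column[OF J a] in auto)
  also have "\<dots> = - (\<Sum>k\<in>?T. \<Sum>b\<in>?T. J $ a $ k * ?Q k b * J $ b $ a) * ?P a a"
    by (simp add: sum_negf sum_distrib_left sum_distrib_right mult.assoc)
  finally have "1 = (J $ a $ a - (\<Sum>k\<in>?T. \<Sum>b\<in>?T. J $ a $ k * ?Q k b * J $ b $ a)) * ?P a a"
    by (simp add: algebra_simps)
  then show ?thesis by (intro inverse_unique[symmetric]) simp
qed

section \<open>Weights along walks\<close>

text \<open>Splits off the factor \<open>j = 2\<close>. In the other factors the front vertex
  \<open>a\<close> passes from the visited prefix to the deleted set, so the tail is weighted in a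
  smaller graph.\<close>

lemma walk_product_Cons:
  assumes "q \<noteq> []" "m \<ge> 1"
  shows "walk_product J S (a # q) (Suc m) =
    principal_inverse J (insert a S) (hd q) (hd q) * J $ hd q $ a * walk_product J (insert a S) q m"
proof -
  let ?f = "\<lambda>j. principal_inverse J (S \<union> set (take (j - 1) (a # q))) ((a # q) ! (j - 1)) ((a # q) ! (j - 1)) *
     J $ ((a # q) ! (j - 1)) $ ((a # q) ! (j - 2))"
  have "walk_product J S (a # q) (Suc m) = ?f 2 * prod ?f {3..Suc m}"
    using assms unfolding walk_product_def
    by (subst prod.atLeast_Suc_atMost) (auto simp: numeral_3_eq_3 numeral_2_eq_2)
  also have "prod ?f {3..Suc m} = (\<Prod>j=2..m. ?f (Suc j))"
    using prod.shift_bounds_cl_Suc_ivl[of ?f 2 m] by (simp add: numeral_3_eq_3 numeral_2_eq_2)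
  also have "\<dots> = walk_product J (insert a S) q m"
    unfolding walk_product_def
  proof (rule prod.cong)
    fix j assume "j \<in> {2..m}"
    \<comment> \<open>This form of \<open>j\<close> lets the truncated subtractions
      \<open>j - 1\<close> and \<open>j - 2\<close> compute.\<close>
    then obtain i where "j = Suc (Suc i)"
      by (metis atLeastAtMost_iff add_2_eq_Suc le_Suc_ex)
    then show "?f (Suc j) = principal_inverse J (insert a S \<union> set (take (j - 1) q)) (q ! (j - 1)) (q ! (j - 1)) *
        J $ (q ! (j - 1)) $ (q ! (j - 2))" by simp
  qed simp
  also have "?f 2 = principal_inverse J (insert a S) (hd q) (hd q) * J $ hd q $ a"
    using assms by (simp add: hd_conv_nth)
  finally show ?thesis .
qed

lemma walk_product_append:
  "m \<le> length q \<Longrightarrow> walk_product J S (q @ r) m = walk_product J S q m"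
  unfolding walk_product_def by (rule prod.cong) (auto simp: nth_append)

text \<open>Traversing the arc \<open>(x, y)\<close> contributes the factor
  \<open>J $ y $ x\<close>. Hence sums over walks of the graph may be extended to lists that ignore
  the arcs.\<close>

lemma walk_product_eq_0:
  assumes "(x, y) \<in> set (vwalk_arcs p)" "J $ y $ x = 0"
  shows "walk_product J S p (length p) = 0"
  using assms
proof (induction p arbitrary: S)
  case (Cons a q)
  then have "q \<noteq> []" by auto
  then show ?case
    using Cons walk_product_Cons[of q "length q" J S a] by (auto simp: Suc_le_eq)
qed simp

section \<open>Path sums over lists of distinct vertices\<close>

text \<open>These are the simple paths of the complete graph on \<open>A\<close>.\<close>

definition distinct_lists :: "'a set \<Rightarrow> 'a \<Rightarrow> 'a \<Rightarrow> 'a list set" where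
  "distinct_lists A a b = {p. p \<noteq> [] \<and> distinct p \<and> set p \<subseteq> A \<and> hd p = a \<and> last p = b}"

lemma finite_distinct_lists:
  "finite A \<Longrightarrow> finite (distinct_lists A a b)"
  by (rule finite_subset[OF _ finite_subset_distinct]) (auto simp: distinct_lists_def)

lemma distinct_lists_self:
  "a \<in> A \<Longrightarrow> distinct_lists A a a = {[a]}"
  unfolding distinct_lists_def
  by (auto simp: neq_Nil_conv split: if_splits)

lemma distinct_lists_Cons:
  assumes "a \<in> A" "a \<noteq> w"
  shows "distinct_lists A a w = (\<Union>b\<in>A - {a}. (#) a ` distinct_lists (A - {a}) b w)"
proof (intro equalityI subsetI)
  fix p assume p: "p \<in> distinct_lists A a w"
  then obtain q where q: "p = a # q" by (cases p) (auto simp: distinct_lists_def)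
  with p assms have "q \<noteq> []" by (auto simp: distinct_lists_def)
  with p q have "q \<in> distinct_lists (A - {a}) (hd q) w" "hd q \<in> A - {a}"
    by (auto simp: distinct_lists_def dest: hd_in_set)
  with q show "p \<in> (\<Union>b\<in>A - {a}. (#) a ` distinct_lists (A - {a}) b w)" by blast
qed (use assms in \<open>auto simp: distinct_lists_def\<close>)

text \<open>The pieces for different \<open>b\<close> are disjoint because \<open>b\<close> is the
  second entry of the list.\<close>

lemma sum_distinct_lists_Cons:
  fixes f :: "'a list \<Rightarrow> real"
  assumes "finite A" "a \<in> A" "a \<noteq> w"
  shows "sum f (distinct_lists A a w) =
    (\<Sum>b\<in>A - {a}. \<Sum>q\<in>distinct_lists (A - {a}) b w. f (a # q))"
proof -
  have "sum f (distinct_lists A a w) = (\<Sum>b\<in>A - {a}. sum f ((#) a ` distinct_lists (A - {a}) b w))"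
    unfolding distinct_lists_Cons[OF assms(2,3)]
    by (rule sum.UNION_disjoint)
      (use assms in \<open>simp_all add: finite_distinct_lists, auto simp: distinct_lists_def\<close>)
  then show ?thesis by (simp add: sum.reindex)
qed

text \<open>Induction on the number of remaining vertices, for all \<open>S\<close> and
  \<open>a\<close> at once, since each step deletes the start vertex. The end \<open>w\<close> stays
  fixed.\<close>

lemma principal_inverse_distinct_lists:
  fixes J :: "real^'n^'n"
  assumes J: "information_matrix J" and "a \<notin> S" "w \<notin> S"
  shows "principal_inverse J S w a =
    (\<Sum>p\<in>distinct_lists (- S) a w. (-1) ^ (length p - 1) * walk_product J S p (length p)) *
      principal_inverse J S a a"
  using assms(2,3)
proof (induction "card (- S)" arbitrary: S a rule: less_induct)
  case less
  show ?case
  proof (cases "a = w")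
    case True
    then show ?thesis using less.prems by (simp add: distinct_lists_self walk_product_def)
  next
    case False
    let ?T = "- insert a S"
    have T: "- S - {a} = ?T" by auto
    have IH: "principal_inverse J (insert a S) w b =
       (\<Sum>q\<in>distinct_lists ?T b w. (-1) ^ (length q - 1) * walk_product J (insert a S) q (length q)) *
       principal_inverse J (insert a S) b b" if "b \<in> ?T" for b
      by (rule less.hyps) (use less.prems that False in \<open>auto intro!: psubset_card_mono\<close>)
    \<comment> \<open>Prepending \<open>a\<close> flips the sign and adds the factor
      \<open>j = 2\<close>. The diagonal entry in that factor is exactly the trailing factor of
      \<open>IH\<close>, so the path sum absorbs it.\<close>
    have step: "(-1) ^ (length (a # q) - 1) * walk_product J S (a # q) (length (a # q)) =
      - ((-1) ^ (length q - 1) * walk_product J (insert a S) q (length q) *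
         principal_inverse J (insert a S) b b * J $ b $ a)"
      if "q \<in> distinct_lists ?T b w" for q b
    proof -
      from that have q: "q \<noteq> []" "hd q = b" by (auto simp: distinct_lists_def)
      then obtain n where "length q = Suc n" by (cases q) auto
      with q walk_product_Cons[of q "length q" J S a] show ?thesis by simp
    qed
    have "(\<Sum>p\<in>distinct_lists (- S) a w. (-1) ^ (length p - 1) * walk_product J S p (length p)) =
      (\<Sum>b\<in>?T. \<Sum>q\<in>distinct_lists ?T b w. - ((-1) ^ (length q - 1) * walk_product J (insert a S) q (length q) *
         principal_inverse J (insert a S) b b * J $ b $ a))"
      using less.prems False step
      by (subst sum_distinct_lists_Cons) (auto simp: T intro!: sum.cong)
    also have "\<dots> = - (\<Sum>b\<in>?T. principal_inverse J (insert a S) w b * J $ b $ a)"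
      by (simp add: IH sum_negf sum_distrib_right)
    finally show ?thesis
      using principal_inverse_column[OF J, of a S w] less.prems False by simp
  qed
qed

section \<open>Simple paths and simple cycles as vertex lists\<close>

lemma verts_delete_verts_matrix_graph:
  "verts (delete_verts (matrix_graph J) S) = - S"
  by (auto simp: delete_verts_def matrix_graph_def)

lemma arcs_ends_delete_verts_matrix_graph:
  "arcs_ends (delete_verts (matrix_graph J) S) = {(i, j). i \<notin> S \<and> j \<notin> S \<and> J $ i $ j \<noteq> 0}"
  by (auto simp: arcs_ends_def arc_to_ends_def delete_verts_def matrix_graph_def induce_subgraph_def
      image_iff)

lemma delete_verts_empty: "delete_verts (matrix_graph J) {} = matrix_graph J"
  by (simp add: delete_verts_def matrix_graph_def induce_subgraph_def)

lemma set_vwalk_arcs_subset: "set (vwalk_arcs p) \<subseteq> set p \<times> set p"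
  by (induction p rule: vwalk_arcs.induct) auto

text \<open>Arcs of the subgraph must also avoid \<open>S\<close>, but their ends are entries of
  \<open>p\<close>, so the vertex condition covers this.\<close>

lemma vwalk_delete_verts_matrix_graph:
  "vwalk p (delete_verts (matrix_graph J) S) \<longleftrightarrow>
    p \<noteq> [] \<and> set p \<subseteq> - S \<and> (\<forall>(i, j)\<in>set (vwalk_arcs p). J $ i $ j \<noteq> 0)"
  using set_vwalk_arcs_subset[of p]
  unfolding vwalk_def verts_delete_verts_matrix_graph arcs_ends_delete_verts_matrix_graph
  by blast

lemma simple_paths_delete_verts:
  "simple_paths (delete_verts (matrix_graph J) S) a w =
    {p \<in> distinct_lists (- S) a w. \<forall>(i, j)\<in>set (vwalk_arcs p). J $ i $ j \<noteq> 0}"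
  unfolding simple_paths_def vpath_def vwalk_delete_verts_matrix_graph distinct_lists_def by auto

lemma finite_simple_paths:
  "finite (simple_paths (delete_verts (matrix_graph J) S) a w)"
  by (simp add: simple_paths_delete_verts finite_distinct_lists)

text \<open>Lists need not follow arcs here, since a list that uses a non-arc has weight zero.\<close>

definition closed_lists :: "'a set \<Rightarrow> 'a \<Rightarrow> 'a list set" where
  "closed_lists A a =
    insert [a, a] (\<Union>k\<in>A - {a}. \<Union>b\<in>A - {a}. (\<lambda>q. a # q @ [a]) ` distinct_lists (A - {a}) b k)"

lemma finite_closed_lists: "finite A \<Longrightarrow> finite (closed_lists A a)"
  by (simp add: closed_lists_def finite_distinct_lists)

text \<open>\<open>closed_lists\<close> sorts the interior by its last vertex \<open>k\<close> and
  first vertex \<open>b\<close>, to match the double sum in \<open>principal_inverse_diag\<close>.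
  Here the sorting is undone; the empty interior is the self-loop.\<close>

lemma closed_lists_iff:
  assumes "a \<in> A"
  shows "p \<in> closed_lists A a \<longleftrightarrow>
    (\<exists>q. p = a # q @ [a] \<and> distinct q \<and> set q \<subseteq> A - {a})"
proof
  assume "\<exists>q. p = a # q @ [a] \<and> distinct q \<and> set q \<subseteq> A - {a}"
  then obtain q where q: "p = a # q @ [a]" "distinct q" "set q \<subseteq> A - {a}" by blast
  show "p \<in> closed_lists A a"
  proof (cases "q = []")
    case False
    then have "q \<in> distinct_lists (A - {a}) (hd q) (last q)"
      "hd q \<in> A - {a}" "last q \<in> A - {a}"
      using q by (auto simp: distinct_lists_def dest: hd_in_set last_in_set)
    then show ?thesis using q(1) unfolding closed_lists_def by blast
  qed (simp add: q closed_lists_def)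
qed (auto simp: closed_lists_def distinct_lists_def)

lemma simple_cycles_delete_verts:
  assumes "a \<notin> S"
  shows "simple_cycles (delete_verts (matrix_graph J) S) a =
    {p \<in> closed_lists (- S) a. \<forall>(i, j)\<in>set (vwalk_arcs p). J $ i $ j \<noteq> 0}"
proof (rule set_eqI)
  fix p
  \<comment> \<open>The part of the cycle condition that does not mention arcs. Length at least 1
    makes the two end copies of \<open>a\<close> distinct positions.\<close>
  have "p \<noteq> [] \<and> set p \<subseteq> - S \<and> length p - 1 \<ge> 1 \<and> hd p = a \<and> last p = a \<and>
     distinct (tl (butlast p)) \<and> a \<notin> set (tl (butlast p)) \<longleftrightarrow>
     (\<exists>q. p = a # q @ [a] \<and> distinct q \<and> set q \<subseteq> - S - {a})" (is "?L \<longleftrightarrow> ?R")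
  proof
    assume L: ?L
    then obtain r where r: "p = a # r" by (cases p) auto
    with L have "r \<noteq> []" by auto
    then have "r = butlast r @ [a]" using L r by (metis append_butlast_last_id last.simps)
    then have "p = a # butlast r @ [a]" using r by simp
    moreover from this have "distinct (butlast r)" "set (butlast r) \<subseteq> - S - {a}"
      using L r \<open>r \<noteq> []\<close> by (auto dest: in_set_butlastD)
    ultimately show ?R by blast
  next
    assume ?R
    then show ?L using assms by (auto simp: butlast_append)
  qed
  then show "p \<in> simple_cycles (delete_verts (matrix_graph J) S) a \<longleftrightarrow>
    p \<in> {p \<in> closed_lists (- S) a. \<forall>(i, j)\<in>set (vwalk_arcs p). J $ i $ j \<noteq> 0}"
    using closed_lists_iff[of a "- S" p] assms
    unfolding simple_cycles_def vwalk_delete_verts_matrix_graph vwalk_length_simp by blast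
qed

lemma finite_simple_cycles:
  assumes "a \<notin> S"
  shows "finite (simple_cycles (delete_verts (matrix_graph J) S) a)"
  by (simp add: simple_cycles_delete_verts[OF assms] finite_closed_lists)

lemma sum_closed_lists:
  fixes f :: "'a list \<Rightarrow> real"
  assumes "finite A"
  shows "sum f (closed_lists A a) = f [a, a] +
    (\<Sum>k\<in>A - {a}. \<Sum>b\<in>A - {a}. \<Sum>q\<in>distinct_lists (A - {a}) b k. f (a # q @ [a]))"
proof -
  let ?c = "\<lambda>q. a # q @ [a]"
  let ?D = "\<lambda>k b. distinct_lists (A - {a}) b k"
  have fin: "finite (?D k b)" for k b using assms by (simp add: finite_distinct_lists)
  have "sum f (closed_lists A a) = f [a, a] + sum f (\<Union>k\<in>A - {a}. \<Union>b\<in>A - {a}. ?c ` ?D k b)"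
    unfolding closed_lists_def
    by (rule sum.insert) (use assms fin in \<open>auto simp: distinct_lists_def\<close>)
  also have "sum f (\<Union>k\<in>A - {a}. \<Union>b\<in>A - {a}. ?c ` ?D k b) =
    (\<Sum>k\<in>A - {a}. sum f (\<Union>b\<in>A - {a}. ?c ` ?D k b))"
    by (rule sum.UNION_disjoint) (use assms fin in \<open>auto simp: distinct_lists_def\<close>)
  also have "\<dots> = (\<Sum>k\<in>A - {a}. \<Sum>b\<in>A - {a}. sum f (?c ` ?D k b))"
    by (intro sum.cong refl sum.UNION_disjoint)
      (use assms fin in \<open>auto simp: distinct_lists_def\<close>)
  finally show ?thesis by (simp add: sum.reindex inj_on_def)
qed

section \<open>The path and cycle formulas on every subgraph\<close>

lemma principal_inverse_simple_paths:
  fixes J :: "real^'n^'n"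
  assumes J: "information_matrix J" and "a \<notin> S" "w \<notin> S"
  shows "principal_inverse J S w a =
    (\<Sum>p\<in>simple_paths (delete_verts (matrix_graph J) S) a w.
      (-1) ^ vwalk_length p * walk_product J S p (vwalk_length p + 1) * principal_inverse J S a a)"
proof -
  have zero: "walk_product J S p (length p) = 0"
    if "(i, j) \<in> set (vwalk_arcs p)" "J $ i $ j = 0" for p i j
    using walk_product_eq_0[of i j p J S] that information_matrix_sym[OF J, of i j] by simp
  have "(\<Sum>p\<in>simple_paths (delete_verts (matrix_graph J) S) a w.
      (-1) ^ vwalk_length p * walk_product J S p (vwalk_length p + 1) * principal_inverse J S a a) =
    (\<Sum>p\<in>distinct_lists (- S) a w.
      (-1) ^ (length p - 1) * walk_product J S p (length p) * principal_inverse J S a a)"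
    unfolding simple_paths_delete_verts
    by (rule sum.mono_neutral_cong_left)
      (simp add: finite_distinct_lists, auto simp: distinct_lists_def Suc_le_eq dest: zero)
  then show ?thesis
    using principal_inverse_distinct_lists[OF assms] by (simp add: sum_distrib_right)
qed

text \<open>Expands the Schur complement: the self-loop gives \<open>J $ a $ a\<close>, and cycles
  leaving \<open>a\<close> to \<open>b\<close> and returning from \<open>k\<close> give the term for
  \<open>k\<close> and \<open>b\<close>, by the path formula with \<open>a\<close> deleted.\<close>

lemma principal_inverse_simple_cycles:
  fixes J :: "real^'n^'n"
  assumes J: "information_matrix J" and a: "a \<notin> S"
  shows "principal_inverse J S a a = inverse
      (\<Sum>p\<in>simple_cycles (delete_verts (matrix_graph J) S) a.
        (-1) ^ (vwalk_length p + 1) * J $ (p ! 0) $ (p ! (vwalk_length p - 1)) *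
        walk_product J S p (vwalk_length p))" (is "_ = inverse (sum ?f _)")
proof -
  let ?T = "- insert a S"
  let ?Q = "principal_inverse J (insert a S)"
  have T: "- S - {a} = ?T" by auto
  \<comment> \<open>The cycle has length \<open>length q + 1\<close>, so its exponent exceeds the
    path exponent \<open>length q - 1\<close> by 3; hence the minus sign.\<close>
  have f_closed: "?f (a # q @ [a]) = - (J $ a $ k *
      ((-1) ^ (length q - 1) * walk_product J (insert a S) q (length q) * ?Q b b) * J $ b $ a)"
    if "q \<in> distinct_lists ?T b k" for q b k
  proof -
    from that have q: "q \<noteq> []" "hd q = b" "last q = k" by (auto simp: distinct_lists_def)
    then obtain n where n: "length q = Suc n" by (cases q) auto
    have "(a # q @ [a]) ! length q = k"
      using q n by (simp add: nth_append last_conv_nth)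
    moreover have "walk_product J S (a # q @ [a]) (Suc (length q)) = walk_product J S (a # q) (Suc (length q))"
      using walk_product_append[of "Suc (length q)" "a # q" J S "[a]"] by simp
    ultimately show ?thesis
      using q n walk_product_Cons[of q "length q" J S a] by simp
  qed
  have f_zero: "?f p = 0"
    if p: "p \<in> closed_lists (- S) a" and ij: "(i, j) \<in> set (vwalk_arcs p)" "J $ i $ j = 0" for p i j
  proof -
    obtain q where q: "p = (a # q) @ [a]"
      using p a by (auto simp: closed_lists_iff)
    \<comment> \<open>The closing arc is weighted by the separate entry of \<open>J\<close> in
      front, all other arcs by \<open>walk_product\<close>.\<close>
    have "(i, j) \<in> set (vwalk_arcs (a # q)) \<or> (i, j) = (last (a # q), a)"
      using ij(1) unfolding q by (subst (asm) vwalk_arcs_append) auto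
    then show ?thesis
    proof
      assume "(i, j) \<in> set (vwalk_arcs (a # q))"
      then have "walk_product J S (a # q) (length (a # q)) = 0"
        using walk_product_eq_0 ij(2) information_matrix_sym[OF J, of i j] by metis
      then show ?thesis
        using walk_product_append[of "length (a # q)" "a # q" J S "[a]"] q by simp
    next
      assume "(i, j) = (last (a # q), a)"
      moreover have "p ! (vwalk_length p - 1) = last (a # q)"
        unfolding q by (simp add: nth_append last_conv_nth nth_Cons')
      ultimately show ?thesis
        using ij(2) information_matrix_sym[OF J, of i j] q by simp
    qed
  qed
  have "sum ?f (simple_cycles (delete_verts (matrix_graph J) S) a) = sum ?f (closed_lists (- S) a)"
    unfolding simple_cycles_delete_verts[OF a]
    by (rule sum.mono_neutral_left) (use f_zero in \<open>auto simp: finite_closed_lists\<close>)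
  also have "\<dots> = ?f [a, a] + (\<Sum>k\<in>?T. \<Sum>b\<in>?T. \<Sum>q\<in>distinct_lists ?T b k. ?f (a # q @ [a]))"
    using sum_closed_lists[of "- S" ?f a] unfolding T by simp
  also have "(\<Sum>k\<in>?T. \<Sum>b\<in>?T. \<Sum>q\<in>distinct_lists ?T b k. ?f (a # q @ [a])) =
    (\<Sum>k\<in>?T. \<Sum>b\<in>?T. - (J $ a $ k * ?Q k b * J $ b $ a))"
  proof (intro sum.cong refl)
    fix k b assume kb: "k \<in> ?T" "b \<in> ?T"
    have "(\<Sum>q\<in>distinct_lists ?T b k. ?f (a # q @ [a])) =
      (\<Sum>q\<in>distinct_lists ?T b k. - (J $ a $ k *
      ((-1) ^ (length q - 1) * walk_product J (insert a S) q (length q) * ?Q b b) * J $ b $ a))"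
      by (rule sum.cong[OF refl]) (rule f_closed)
    also have "\<dots> = - (J $ a $ k * ?Q k b * J $ b $ a)"
      using principal_inverse_distinct_lists[OF J, of b "insert a S" k] kb
      by (simp add: sum_negf sum_distrib_left sum_distrib_right)
    finally show "(\<Sum>q\<in>distinct_lists ?T b k. ?f (a # q @ [a])) = - (J $ a $ k * ?Q k b * J $ b $ a)" .
  qed
  also have "?f [a, a] = J $ a $ a" by (simp add: walk_product_def)
  finally have "sum ?f (simple_cycles (delete_verts (matrix_graph J) S) a) = J $ a $ a -
    (\<Sum>k\<in>?T. \<Sum>b\<in>?T. J $ a $ k * ?Q k b * J $ b $ a)"
    by (simp add: sum_negf)
  then show ?thesis using principal_inverse_diag[OF J a] by simp
qed

text \<open>The last conjunct makes the recursion explicit: the diagonal entries inside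
  \<open>walk_product\<close> belong to strictly larger deleted sets, so repeated expansion
  ends.\<close>

theorem theorem2:
  fixes J :: "real^'n^'n"
  assumes "information_matrix J"
  shows "(\<forall>\<alpha> \<omega>. finite (simple_paths (matrix_graph J) \<alpha> \<omega>)) \<and>
    (\<forall>\<alpha>. finite (simple_cycles (matrix_graph J) \<alpha>)) \<and>
    (\<forall>\<alpha> \<omega>. matrix_inv J $ \<omega> $ \<alpha> =
      (\<Sum>p\<in>simple_paths (matrix_graph J) \<alpha> \<omega>.
        (-1) ^ vwalk_length p * walk_product J {} p (vwalk_length p + 1) * matrix_inv J $ \<alpha> $ \<alpha>)) \<and>
    (\<forall>\<alpha>. matrix_inv J $ \<alpha> $ \<alpha> = inverse
      (\<Sum>\<gamma>\<in>simple_cycles (matrix_graph J) \<alpha>.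
        (-1) ^ (vwalk_length \<gamma> + 1) * J $ (\<gamma> ! 0) $ (\<gamma> ! (vwalk_length \<gamma> - 1)) *
        walk_product J {} \<gamma> (vwalk_length \<gamma>))) \<and>
    (\<forall>S \<alpha>. \<alpha> \<notin> S \<longrightarrow> principal_inverse J S \<alpha> \<alpha> = inverse
      (\<Sum>\<gamma>\<in>simple_cycles (delete_verts (matrix_graph J) S) \<alpha>.
        (-1) ^ (vwalk_length \<gamma> + 1) * J $ (\<gamma> ! 0) $ (\<gamma> ! (vwalk_length \<gamma> - 1)) *
        walk_product J S \<gamma> (vwalk_length \<gamma>)))"
proof (intro conjI allI impI)
  fix \<alpha> \<omega> :: 'n and S :: "'n set"
  show "finite (simple_paths (matrix_graph J) \<alpha> \<omega>)"
    using finite_simple_paths[of J "{}"] by (simp add: delete_verts_empty)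
  show "finite (simple_cycles (matrix_graph J) \<alpha>)"
    using finite_simple_cycles[of \<alpha> "{}" J] by (simp add: delete_verts_empty)
qed (use principal_inverse_simple_paths[OF assms, of _ "{}", unfolded delete_verts_empty]
      principal_inverse_simple_cycles[OF assms]
      principal_inverse_simple_cycles[OF assms, of _ "{}", unfolded delete_verts_empty]
    in \<open>unfold matrix_inv_eq_principal_inverse[OF assms], blast+\<close>)

end
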